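(* Let $Q\subseteq\mathbb{F}_2^m$ and $R\subseteq\mathbb{F}_2^n$, and define \[Q\#R:=\{\mathbf{0}_{m+n}\}\cup\{\mathbf{u}\mathbf{1}_n\mid \mathbf{u}\in Q\setminus\{\mathbf{0}_m\}\}\cup\{\mathbf{1}_m\mathbf{v}\mid \mathbf{v}\in R\setminus\{\mathbf{0}_n\}\}\cup\{\mathbf{1}_{m+n}\}\subseteq\mathbb{F}_2^{m+n}.\] Then $Q\#R$ is a powerful set if and only if $Q$ and $R$ are both powerful sets and one of the following holds: (a) one of $Q,R$ consists only of a zero vector and possibly an all-one vector, while the other contains an all-one vector; or (b) $|Q|=|R|$ and neither $Q$ nor $R$ contains an all-one vector. Furthermore, if $Q\#R$ is a powerful set, then $Q\#R$ is nonlinear (not a linear subspace of $\mathbb{F}_2^{m+n}$) unless each of $Q$ and $R$ consists just of a zero vector and possibly an all-one vector.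
   Context: $\mathbf{0}_k$ and $\mathbf{1}_k$ denote the all-zero and all-one row vectors of length $k$; juxtaposition of vectors denotes concatenation. A set $S\subseteq\mathbb{F}_2^n$ (positions indexed by $[n]$) is a powerful set if for every $X\subseteq[n]$ the number of vectors in $S$ that are zero in all positions of $X$ is a power of $2$.
   Formalization: The formal version assumes Q and R contain the zero vector, that m,n ≥ 1, and, for the equivalence, that |Q| and |R| are powers of 2; as printed the "only if" fails, e.g. Q = {00,01,10}, R = {0}, where Q#R is powerful but Q is not. *)

theory Defs
  imports "HOL-Analysis.Analysis" "HOL-Library.Z2"
begin

text \<open>
  Vectors of \<open>\<bbbF>\<^sub>2\<^sup>n\<close> are elements of \<^typ>\<open>bit ^ 'n\<close>, so the length is \<open>CARD('n) \<ge> 1\<close>; the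
  constants \<open>0\<close> and \<open>1\<close> of this type are the all-zero and the all-one vector.  The
  positions of \<open>\<bbbF>\<^sub>2\<^sup>m\<^sup>+\<^sup>n\<close> are indexed by the sum type \<^typ>\<open>'m + 'n\<close>.
\<close>

definition powerful :: "(bit ^ 'n) set \<Rightarrow> bool" where
  "powerful S \<longleftrightarrow> (\<forall>X. \<exists>k. card {v \<in> S. \<forall>i\<in>X. v $ i = 0} = 2 ^ k)"

definition vconcat :: "bit ^ 'm \<Rightarrow> bit ^ 'n \<Rightarrow> bit ^ ('m + 'n)" where
  "vconcat u v = (\<chi> k. case k of Inl i \<Rightarrow> u $ i | Inr j \<Rightarrow> v $ j)"

definition hash :: "(bit ^ 'm) set \<Rightarrow> (bit ^ 'n) set \<Rightarrow> (bit ^ ('m + 'n)) set"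
    (infixl "\<sharp>" 65) where
  "Q \<sharp> R = {0} \<union> {vconcat u 1 | u. u \<in> Q - {0}} \<union> {vconcat 1 v | v. v \<in> R - {0}} \<union> {1}"

definition only_zero_or_one :: "(bit ^ 'n) set \<Rightarrow> bool" where
  "only_zero_or_one S \<longleftrightarrow> S = {0} \<or> S = {0, 1}"

text \<open>
  \<open>Q \<sharp> R\<close> does not determine whether \<open>0\<close> or \<open>1\<close> belong to \<open>Q\<close>, and in general \<open>Q \<sharp> R\<close> can be
  powerful without \<open>Q\<close> being powerful, as the next two facts show.  What is missing is
  exactly that \<open>0\<close> is in \<open>Q\<close> and in \<open>R\<close> and that \<open>card Q\<close> and \<open>card R\<close> are powers of \<open>2\<close>, i.e.
  the instances \<open>X = UNIV\<close> and \<open>X = {}\<close> of \<^const>\<open>powerful\<close>.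
\<close>

lemma powerful_hash_empty:
  "powerful (({} :: (bit ^ 'm) set) \<sharp> ({} :: (bit ^ 'n) set))"
  "\<not> powerful ({} :: (bit ^ 'm) set)"
proof -
  have eq: "{v \<in> {0, 1}. \<forall>i\<in>X. v $ i = 0} = (if X = {} then {0, 1 :: bit ^ ('m + 'n)} else {0})"
    for X by auto
  have "(0 :: bit ^ ('m + 'n)) \<noteq> 1"
    by (simp add: vec_eq_iff)
  then have "\<exists>k. card {v \<in> {0, 1 :: bit ^ ('m + 'n)}. \<forall>i\<in>X. v $ i = 0} = 2 ^ k" for X
    unfolding eq by (cases "X = {}") (auto intro: exI[of _ 0] exI[of _ 1])
  then show "powerful (({} :: (bit ^ 'm) set) \<sharp> ({} :: (bit ^ 'n) set))"
    by (simp add: powerful_def hash_def insert_commute)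
qed (simp add: powerful_def)

lemma powerful_hash_nonpowerful:
  defines "Q \<equiv> - {1} :: (bit ^ bool) set" and "R \<equiv> {0} :: (bit ^ unit) set"
  shows "0 \<in> Q" "0 \<in> R" "powerful (Q \<sharp> R)" "\<not> powerful Q"
proof -
  define a b :: "bit ^ bool" where "a = (\<chi> i. of_bool i)" and "b = (\<chi> i. of_bool (\<not> i))"
  note ab = a_def b_def vec_eq_iff all_bool_eq vconcat_def
  have Q: "Q = {0, a, b}"
  proof -
    have "x \<noteq> 1 \<longleftrightarrow> x = 0 \<or> x = a \<or> x = b" for x :: "bit ^ bool"
      by (cases "x $ True"; cases "x $ False") (auto simp: ab)
    then show ?thesis by (auto simp: Q_def)
  qed
  have dist: "0 \<noteq> a" "0 \<noteq> b" "a \<noteq> b"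
    by (auto simp: ab)
  show "0 \<in> Q" "0 \<in> R"
    by (simp_all add: Q R_def)
  have "card Q = 3"
    using dist by (simp add: Q)
  moreover have "(3::nat) \<noteq> 2 ^ k" for k
    by (cases k) (auto dest: arg_cong[where f = even])
  ultimately show "\<not> powerful Q"
    unfolding powerful_def by (auto intro!: exI[of _ "{}"])
  define c d :: "bit ^ (bool + unit)" where "c = vconcat a 1" and "d = vconcat b 1"
  have S: "Q \<sharp> R = {0, c, d, 1}"
    using dist by (auto simp: hash_def Q R_def c_def d_def)
  have cd: "c $ Inl i = of_bool i" "d $ Inl i = of_bool (\<not> i)" "c $ Inr j = 1" "d $ Inr j = 1"
    for i j by (simp_all add: c_def d_def ab)
  have dist': "0 \<noteq> c" "0 \<noteq> d" "c \<noteq> d" "0 \<noteq> (1 :: bit ^ (bool + unit))" "c \<noteq> 1" "d \<noteq> 1"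
    by (auto simp: vec_eq_iff split_sum_all all_bool_eq cd)
  have "\<exists>k. card {v \<in> {0, c, d, 1}. \<forall>i\<in>X. v $ i = 0} = 2 ^ k" for X
  proof -
    have c: "(\<forall>i\<in>X. c $ i = 0) \<longleftrightarrow> X \<subseteq> {Inl False}"
    proof -
      have "c $ i = 0 \<longleftrightarrow> i = Inl False" for i by (cases i) (auto simp: cd)
      then show ?thesis by auto
    qed
    have d: "(\<forall>i\<in>X. d $ i = 0) \<longleftrightarrow> X \<subseteq> {Inl True}"
    proof -
      have "d $ i = 0 \<longleftrightarrow> i = Inl True" for i by (cases i) (auto simp: cd)
      then show ?thesis by auto
    qed
    consider "X = {}" | "X = {Inl False}" | "X = {Inl True}"
      | "X \<noteq> {}" "\<not> X \<subseteq> {Inl False}" "\<not> X \<subseteq> {Inl True}"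
      by blast
    then show ?thesis
    proof cases
      case 1
      then have eq: "{v \<in> {0, c, d, 1}. \<forall>i\<in>X. v $ i = 0} = {0, c, d, 1}"
        by auto
      show ?thesis unfolding eq using dist' by (intro exI[of _ 2]) simp
    next
      case 2
      then have eq: "{v \<in> {0, c, d, 1}. \<forall>i\<in>X. v $ i = 0} = {0, c}"
        by (auto simp: cd)
      show ?thesis unfolding eq using dist' by (intro exI[of _ 1]) simp
    next
      case 3
      then have eq: "{v \<in> {0, c, d, 1}. \<forall>i\<in>X. v $ i = 0} = {0, d}"
        by (auto simp: cd)
      show ?thesis unfolding eq using dist' by (intro exI[of _ 1]) simp
    next
      case 4
      then have "\<not> (\<forall>i\<in>X. c $ i = 0)" "\<not> (\<forall>i\<in>X. d $ i = 0)"
          "\<not> (\<forall>i\<in>X. (1 :: bit ^ (bool + unit)) $ i = 0)" "\<forall>i\<in>X. (0 :: bit ^ (bool + unit)) $ i = 0"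
        unfolding c d by auto
      then have eq: "{v \<in> {0, c, d, 1}. \<forall>i\<in>X. v $ i = 0} = {0}"
        by blast
      show ?thesis unfolding eq by (intro exI[of _ 0]) simp
    qed
  qed
  then show "powerful (Q \<sharp> R)"
    by (simp add: powerful_def S)
qed

end

theory Submission
  imports Defs
begin

text \<open>
  A vector of \<open>Q \<sharp> R\<close> that vanishes at a position of the first block is \<open>0\<close> or \<open>vconcat u 1\<close> with
  \<open>u \<in> Q\<close>, and symmetrically for the second block.  Hence for \<open>X \<noteq> {}\<close> the count for \<open>Q \<sharp> R\<close> is
  \<open>1\<close> or a count for \<open>Q\<close> or for \<open>R\<close>, and the only new condition comes from \<open>X = {}\<close>: the number
  \<open>2 + card (Q - {0, 1}) + card (R - {0, 1})\<close> has to be a power of \<open>2\<close>.  As \<open>card Q\<close> and \<open>card R\<close>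
  are powers of \<open>2\<close>, this leaves the listed cases, according to which of \<open>Q\<close>, \<open>R\<close> contain \<open>1\<close>.
  For nonlinearity, the sum of \<open>1\<close> and \<open>vconcat u 1\<close> with \<open>u \<notin> {0, 1}\<close> is zero on the second
  block and neither \<open>0\<close> nor \<open>1\<close> on the first, so it lies outside \<open>Q \<sharp> R\<close>.
\<close>

text \<open>Makes \<open>bit ^ 'n\<close> a finite type, so every set of vectors is finite and
  \<open>card\<close> is a genuine count.\<close>

instance bit :: finite
proof
  have "(UNIV :: bit set) = {0, 1}"
    using bit.exhaust by auto
  then show "finite (UNIV :: bit set)"
    by (metis finite.emptyI finite.insertI)
qed

section \<open>Concatenated vectors and membership in \<open>Q \<sharp> R\<close>\<close>

lemma vec_zero_neq_one: "(0 :: bit ^ 'n) \<noteq> 1"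
  by (simp add: vec_eq_iff)

lemma vconcat_nth [simp]: "vconcat u v $ Inl i = u $ i" "vconcat u v $ Inr j = v $ j"
  by (simp_all add: vconcat_def)

lemma vec_sum_eq_iff:
  fixes w z :: "bit ^ ('m::finite + 'n::finite)"
  shows "w = z \<longleftrightarrow> (\<forall>i. w $ Inl i = z $ Inl i) \<and> (\<forall>j. w $ Inr j = z $ Inr j)"
  by (simp add: vec_eq_iff split_sum_all)

lemma vconcat_eq_iff [simp]: "vconcat u v = vconcat u' v' \<longleftrightarrow> u = u' \<and> v = v'"
  by (auto simp: vec_sum_eq_iff) (simp_all add: vec_eq_iff)

lemma vconcat_eq_zero_iff [simp]: "vconcat u v = 0 \<longleftrightarrow> u = 0 \<and> v = 0"
  by (auto simp: vec_sum_eq_iff) (simp_all add: vec_eq_iff)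

lemma vconcat_eq_one_iff [simp]: "vconcat u v = 1 \<longleftrightarrow> u = 1 \<and> v = 1"
  by (auto simp: vec_sum_eq_iff) (simp_all add: vec_eq_iff)

lemma mem_hash_iff:
  "w \<in> Q \<sharp> R \<longleftrightarrow>
    w = 0 \<or> w = 1 \<or> (\<exists>u\<in>Q - {0}. w = vconcat u 1) \<or> (\<exists>v\<in>R - {0}. w = vconcat 1 v)"
  by (auto simp: hash_def)

section \<open>Counting the vectors of \<open>Q \<sharp> R\<close> with prescribed zeros\<close>

lemma card_hash_zeros_left:
  fixes Q :: "(bit ^ 'm) set" and R :: "(bit ^ 'n) set"
  assumes "0 \<in> Q" and "A \<noteq> {}"
  shows "card {w \<in> Q \<sharp> R. \<forall>k\<in>Inl ` A. w $ k = 0} = card {u \<in> Q. \<forall>i\<in>A. u $ i = 0}"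
proof -
  \<comment> \<open>\<open>vconcat 0 1\<close> is never in \<open>Q \<sharp> R\<close>, so the
    vector \<open>0\<close> of \<open>Q\<close> is matched with \<open>0\<close> instead.\<close>
  define g :: "bit ^ 'm \<Rightarrow> bit ^ ('m + 'n)" where "g u = (if u = 0 then 0 else vconcat u 1)" for u
  have "{w \<in> Q \<sharp> R. \<forall>k\<in>Inl ` A. w $ k = 0} = g ` {u \<in> Q. \<forall>i\<in>A. u $ i = 0}"
    using assms by (auto simp: mem_hash_iff g_def image_iff)
  moreover have "inj_on g B" for B
    by (auto simp: inj_on_def g_def split: if_splits dest: sym)
  ultimately show ?thesis
    by (simp add: card_image)
qed

lemma card_hash_zeros_right:
  fixes Q :: "(bit ^ 'm) set" and R :: "(bit ^ 'n) set"
  assumes "0 \<in> R" and "B \<noteq> {}"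
  shows "card {w \<in> Q \<sharp> R. \<forall>k\<in>Inr ` B. w $ k = 0} = card {v \<in> R. \<forall>j\<in>B. v $ j = 0}"
proof -
  define g :: "bit ^ 'n \<Rightarrow> bit ^ ('m + 'n)" where "g v = (if v = 0 then 0 else vconcat 1 v)" for v
  have "{w \<in> Q \<sharp> R. \<forall>k\<in>Inr ` B. w $ k = 0} = g ` {v \<in> R. \<forall>j\<in>B. v $ j = 0}"
    using assms by (auto simp: mem_hash_iff g_def image_iff)
  moreover have "inj_on g C" for C
    by (auto simp: inj_on_def g_def split: if_splits dest: sym)
  ultimately show ?thesis
    by (simp add: card_image)
qed

lemma hash_zeros_both:
  assumes "Inl i \<in> X" and "Inr j \<in> X"
  shows "{w \<in> Q \<sharp> R. \<forall>k\<in>X. w $ k = 0} = {0}"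
  using assms by (force simp: mem_hash_iff)

text \<open>If \<open>1\<close> lies in \<open>Q\<close> or in \<open>R\<close>, it only yields
  \<open>vconcat 1 1 = 1\<close> again; removing \<open>0\<close> and \<open>1\<close> from both
  sets makes the pieces disjoint.\<close>

lemma card_hash:
  fixes Q :: "(bit ^ 'm) set" and R :: "(bit ^ 'n) set"
  shows "card (Q \<sharp> R) = 2 + card (Q - {0, 1}) + card (R - {0, 1})"
proof -
  let ?f = "\<lambda>u. vconcat u (1 :: bit ^ 'n)" and ?g = "vconcat (1 :: bit ^ 'm)"
  have "Q \<sharp> R = {0, 1} \<union> (?f ` (Q - {0, 1}) \<union> ?g ` (R - {0, 1}))"
    by (auto simp: mem_hash_iff image_iff Bex_def) blast
  moreover have "card ({0, 1} \<union> (?f ` (Q - {0, 1}) \<union> ?g ` (R - {0, 1})))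
      = card {0, 1 :: bit ^ ('m + 'n)} + card (?f ` (Q - {0, 1}) \<union> ?g ` (R - {0, 1}))"
    by (rule card_Un_disjoint) (auto simp: eq_commute[of _ "vconcat _ _"])
  moreover have "card (?f ` (Q - {0, 1}) \<union> ?g ` (R - {0, 1}))
      = card (?f ` (Q - {0, 1})) + card (?g ` (R - {0, 1}))"
    by (rule card_Un_disjoint) auto
  ultimately show ?thesis
    by (simp add: card_image inj_on_def vec_zero_neq_one)
qed

text \<open>The forward direction cannot read the counts of \<open>Q\<close> and \<open>R\<close> at
  the empty set of positions off \<open>Q \<sharp> R\<close>; the cardinality hypotheses supply
  them.\<close>

lemma powerful_hash_iff:
  fixes Q :: "(bit ^ 'm) set" and R :: "(bit ^ 'n) set"
  assumes Q: "0 \<in> Q" "\<exists>k. card Q = 2 ^ k" and R: "0 \<in> R" "\<exists>k. card R = 2 ^ k"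
  shows "powerful (Q \<sharp> R) \<longleftrightarrow> powerful Q \<and> powerful R \<and> (\<exists>k. card (Q \<sharp> R) = 2 ^ k)"
proof (intro iffI conjI)
  assume *: "powerful (Q \<sharp> R)"
  show "powerful Q"
    unfolding powerful_def
  proof
    fix A
    show "\<exists>k. card {u \<in> Q. \<forall>i\<in>A. u $ i = 0} = 2 ^ k"
      using * Q card_hash_zeros_left[OF Q(1), of A R] unfolding powerful_def
      by (cases "A = {}") (simp, metis)
  qed
  show "powerful R"
    unfolding powerful_def
  proof
    fix B
    show "\<exists>k. card {v \<in> R. \<forall>j\<in>B. v $ j = 0} = 2 ^ k"
      using * R card_hash_zeros_right[OF R(1), of B Q] unfolding powerful_def
      by (cases "B = {}") (simp, metis)
  qed
  show "\<exists>k. card (Q \<sharp> R) = 2 ^ k"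
    using *[unfolded powerful_def, rule_format, of "{}"] by simp
next
  assume *: "powerful Q \<and> powerful R \<and> (\<exists>k. card (Q \<sharp> R) = 2 ^ k)"
  show "powerful (Q \<sharp> R)"
    unfolding powerful_def
  proof
    fix X :: "('m + 'n) set"
    let ?A = "Inl -` X" and ?B = "Inr -` X"
    have X: "X = Inl ` ?A \<union> Inr ` ?B"
    proof -
      have "x \<in> X \<longleftrightarrow> x \<in> Inl ` ?A \<union> Inr ` ?B" for x
        by (cases x) auto
      then show ?thesis by blast
    qed
    consider "X = {}" | "?A \<noteq> {}" "X = Inl ` ?A" | "?B \<noteq> {}" "X = Inr ` ?B"
      | "?A \<noteq> {}" "?B \<noteq> {}"
      using X by (cases "?A = {}"; cases "?B = {}") auto
    then show "\<exists>k. card {w \<in> Q \<sharp> R. \<forall>k\<in>X. w $ k = 0} = 2 ^ k"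
    proof cases
      case 1
      then show ?thesis using * by simp
    next
      case 2
      then show ?thesis
        using * card_hash_zeros_left[OF Q(1), of ?A R] unfolding powerful_def by metis
    next
      case 3
      then show ?thesis
        using * card_hash_zeros_right[OF R(1), of ?B Q] unfolding powerful_def by metis
    next
      case 4
      then obtain i j where "Inl i \<in> X" "Inr j \<in> X"
        by auto
      from hash_zeros_both[OF this, of Q R] show ?thesis
        by (intro exI[of _ 0]) simp
    qed
  qed
qed

section \<open>Sums of two powers of two that exceed a power of two by 0, 1 or 2\<close>

text \<open>For \<open>i < j\<close> the sum lies strictly between \<open>2 ^ j\<close> and
  \<open>2 ^ Suc j\<close>.\<close>

lemma sum_powers_of_two_eq_power_iff:
  "(\<exists>k. 2 ^ i + 2 ^ j = (2 :: nat) ^ k) \<longleftrightarrow> i = j"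
proof
  have less: False if "i < j" "2 ^ i + 2 ^ j = (2 :: nat) ^ k" for i j k :: nat
  proof -
    have "(2 :: nat) ^ i < 2 ^ j"
      using that(1) by simp
    then have "(2 :: nat) ^ j < 2 ^ k" "(2 :: nat) ^ k < 2 ^ Suc j"
      using that(2)[symmetric] by simp_all
    then have "j < k" "k < Suc j"
      by (simp_all only: power_strict_increasing_iff one_less_numeral_iff semiring_norm)
    then show False
      by simp
  qed
  assume "\<exists>k. 2 ^ i + 2 ^ j = (2 :: nat) ^ k"
  then show "i = j"
    using less[of i j] less[of j i] by (metis add.commute linorder_neqE_nat)
qed (auto intro: exI[of _ "Suc j"])

text \<open>A parity argument. The case \<open>i = 0\<close> is excluded because then every
  \<open>j\<close> works, with \<open>k = j\<close>.\<close>

lemma sum_powers_of_two_eq_power_plus_one_iff: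
  assumes "i \<noteq> 0"
  shows "(\<exists>k. 2 ^ i + 2 ^ j = (2 :: nat) ^ k + 1) \<longleftrightarrow> j = 0"
proof
  assume "\<exists>k. 2 ^ i + 2 ^ j = (2 :: nat) ^ k + 1"
  then obtain k where k: "2 ^ i + 2 ^ j = (2 :: nat) ^ k + 1" ..
  show "j = 0"
  proof (rule ccontr)
    assume "j \<noteq> 0"
    then obtain i' j' where "i = Suc i'" "j = Suc j'"
      using assms by (metis not0_implies_Suc)
    then have "2 * (2 ^ i' + 2 ^ j') = (2 :: nat) ^ k + 1"
      using k by simp
    moreover have "(2 :: nat) ^ i' > 0" "(2 :: nat) ^ j' > 0"
      by simp_all
    \<comment> \<open>For \<open>k > 0\<close> the two sides differ in parity; for
      \<open>k = 0\<close> the right side is 2 and the left at least 4.\<close>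
    ultimately show False
      by (cases k) (simp_all, presburger)
  qed
qed auto

text \<open>Halving both sides reduces this to the excess 1; \<open>k = 0\<close> is impossible, as
  the right side would be 3.\<close>

lemma sum_powers_of_two_eq_power_plus_two_iff:
  assumes "i \<noteq> 0" and "j \<noteq> 0"
  shows "(\<exists>k. 2 ^ i + 2 ^ j = (2 :: nat) ^ k + 2) \<longleftrightarrow> i = 1 \<or> j = 1"
proof -
  obtain i' j' where *: "i = Suc i'" "j = Suc j'"
    using assms by (metis not0_implies_Suc)
  have "(\<exists>k. 2 ^ i + 2 ^ j = (2 :: nat) ^ k + 2) \<longleftrightarrow> (\<exists>k. 2 ^ i' + 2 ^ j' = (2 :: nat) ^ k + 1)"
  proof
    assume "\<exists>k. 2 ^ i + 2 ^ j = (2 :: nat) ^ k + 2"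
    then obtain k where k: "2 * (2 ^ i' + 2 ^ j') = (2 :: nat) ^ k + 2"
      by (auto simp: *)
    then obtain k' where "k = Suc k'"
      by (cases k) (simp, presburger)
    with k have "2 ^ i' + 2 ^ j' = (2 :: nat) ^ k' + 1"
      by simp
    then show "\<exists>k. 2 ^ i' + 2 ^ j' = (2 :: nat) ^ k + 1" ..
  next
    assume "\<exists>k. 2 ^ i' + 2 ^ j' = (2 :: nat) ^ k + 1"
    then obtain k where "2 ^ i' + 2 ^ j' = (2 :: nat) ^ k + 1" ..
    then have "2 ^ i + 2 ^ j = (2 :: nat) ^ Suc k + 2"
      by (simp add: *)
    then show "\<exists>k. 2 ^ i + 2 ^ j = (2 :: nat) ^ k + 2" ..
  qed
  also have "\<dots> \<longleftrightarrow> i' = 0 \<or> j' = 0"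
    using sum_powers_of_two_eq_power_plus_one_iff[of i' j'] by (cases "i' = 0") auto
  finally show ?thesis
    by (simp add: *)
qed

section \<open>When the cardinality of \<open>Q \<sharp> R\<close> is a power of two\<close>

lemma card_eq_card_Diff_zero_one:
  fixes S :: "(bit ^ 'n) set"
  assumes "0 \<in> S"
  shows "card S = card (S - {0, 1}) + (if 1 \<in> S then 2 else 1)"
proof -
  let ?T = "if 1 \<in> S then {0, 1} else {0 :: bit ^ 'n}"
  have "S = (S - {0, 1}) \<union> ?T"
    using assms by auto
  moreover have "card ((S - {0, 1}) \<union> ?T) = card (S - {0, 1}) + card ?T"
    by (rule card_Un_disjoint) auto
  ultimately have "card S = card (S - {0, 1}) + card ?T"
    by simp
  then show ?thesis
    by (simp add: vec_zero_neq_one)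
qed

lemma only_zero_or_one_iff:
  assumes "0 \<in> S"
  shows "only_zero_or_one S \<longleftrightarrow> S \<subseteq> {0, 1}"
  using assms by (auto simp: only_zero_or_one_def)

text \<open>Turns a condition on the set into one on the exponent of its cardinality.\<close>

lemma only_zero_or_one_iff_card:
  fixes S :: "(bit ^ 'n) set"
  assumes "0 \<in> S"
  shows "only_zero_or_one S \<longleftrightarrow> card S = (if 1 \<in> S then 2 else 1)"
  using card_eq_card_Diff_zero_one[OF assms] by (auto simp: only_zero_or_one_iff[OF assms])

lemma card_hash_eq_power_iff:
  fixes Q :: "(bit ^ 'm) set" and R :: "(bit ^ 'n) set"
  assumes Q: "0 \<in> Q" "card Q = 2 ^ i" and R: "0 \<in> R" "card R = 2 ^ j"
  shows "(\<exists>k. card (Q \<sharp> R) = 2 ^ k) \<longleftrightarrow>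
    (only_zero_or_one Q \<and> 1 \<in> R \<or> only_zero_or_one R \<and> 1 \<in> Q) \<or>
    (card Q = card R \<and> 1 \<notin> Q \<and> 1 \<notin> R)"
proof -
  note cardQ = card_eq_card_Diff_zero_one[OF Q(1), unfolded Q(2)]
    and cardR = card_eq_card_Diff_zero_one[OF R(1), unfolded R(2)]
  \<comment> \<open>A set containing both \<open>0\<close> and \<open>1\<close> has at least two
    elements.\<close>
  have nz: "1 \<in> Q \<Longrightarrow> i \<noteq> 0" "1 \<in> R \<Longrightarrow> j \<noteq> 0"
    using cardQ cardR by (auto intro!: gr0I)
  have only: "only_zero_or_one Q \<longleftrightarrow> i = of_bool (1 \<in> Q)"
    "only_zero_or_one R \<longleftrightarrow> j = of_bool (1 \<in> R)"
    using power_inject_exp[of "2::nat" _ 1]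
    by (auto simp: only_zero_or_one_iff_card Q R)
  \<comment> \<open>The vectors \<open>0\<close> and \<open>1\<close> of \<open>Q \<sharp> R\<close>
    balance the zero vectors of \<open>Q\<close> and \<open>R\<close>, so only the all-one vectors
    of \<open>Q\<close> and \<open>R\<close> are in excess.\<close>
  have "card (Q \<sharp> R) + of_bool (1 \<in> Q) + of_bool (1 \<in> R) = 2 ^ i + 2 ^ j"
    using cardQ cardR by (auto simp: card_hash)
  then have *: "(\<exists>k. card (Q \<sharp> R) = 2 ^ k) \<longleftrightarrow>
      (\<exists>k. 2 ^ i + 2 ^ j = 2 ^ k + of_bool (1 \<in> Q) + (of_bool (1 \<in> R) :: nat))"
    by (metis add_right_cancel)
  consider "1 \<in> Q" "1 \<in> R" | "1 \<in> Q" "1 \<notin> R" | "1 \<notin> Q" "1 \<in> R" | "1 \<notin> Q" "1 \<notin> R"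
    by blast
  then show ?thesis
  proof cases
    case 1
    then show ?thesis
      using sum_powers_of_two_eq_power_plus_two_iff[of i j] nz by (simp add: * only)
  next
    case 2
    then show ?thesis
      using sum_powers_of_two_eq_power_plus_one_iff[of i j] nz by (simp add: * only)
  next
    case 3
    then show ?thesis
      using sum_powers_of_two_eq_power_plus_one_iff[of j i] nz
      by (simp add: * only add.commute[of "2 ^ i"])
  next
    case 4
    then show ?thesis
      by (simp add: * Q R sum_powers_of_two_eq_power_iff)
  qed
qed

section \<open>Nonlinearity\<close>

lemma subspace_hash_imp_only_zero_or_one:
  fixes Q :: "(bit ^ 'm) set" and R :: "(bit ^ 'n) set"
  assumes "0 \<in> Q" and "0 \<in> R" and sub: "vec.subspace (Q \<sharp> R)"
  shows "only_zero_or_one Q \<and> only_zero_or_one R"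
proof -
  have add_one: "w + 1 \<in> Q \<sharp> R" if "w \<in> Q \<sharp> R" for w
    using that by (intro vec.subspace_add[OF sub]) (simp_all add: mem_hash_iff)
  have "u = 0 \<or> u = 1" if "u \<in> Q" for u
  proof (rule ccontr)
    assume u: "\<not> (u = 0 \<or> u = 1)"
    have "vconcat u 1 \<in> Q \<sharp> R"
      using that u by (auto simp: mem_hash_iff)
    moreover have "vconcat u 1 + 1 = vconcat (u + 1) 0"
      by (simp add: vec_sum_eq_iff)
    ultimately have "vconcat (u + 1) 0 \<in> Q \<sharp> R"
      using add_one by metis
    \<comment> \<open>The only vector of \<open>Q \<sharp> R\<close> with second block
      \<open>0\<close> is \<open>0\<close> itself, and \<open>u + 1 = 0\<close> would mean
      \<open>u = 1\<close>.\<close>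
    with u show False
      by (auto simp: mem_hash_iff vec_zero_neq_one) (auto simp: vec_eq_iff)
  qed
  moreover have "v = 0 \<or> v = 1" if "v \<in> R" for v
  proof (rule ccontr)
    assume v: "\<not> (v = 0 \<or> v = 1)"
    have "vconcat 1 v \<in> Q \<sharp> R"
      using that v by (auto simp: mem_hash_iff)
    moreover have "vconcat 1 v + 1 = vconcat 0 (v + 1)"
      by (simp add: vec_sum_eq_iff)
    ultimately have "vconcat 0 (v + 1) \<in> Q \<sharp> R"
      using add_one by metis
    with v show False
      by (auto simp: mem_hash_iff vec_zero_neq_one) (auto simp: vec_eq_iff)
  qed
  ultimately show ?thesis
    using assms by (auto simp: only_zero_or_one_iff)
qed

theorem theorem10:
  fixes Q :: "(bit ^ 'm) set" and R :: "(bit ^ 'n) set"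
  assumes "0 \<in> Q" and "0 \<in> R"
  shows "((\<exists>k. card Q = 2 ^ k) \<and> (\<exists>k. card R = 2 ^ k) \<longrightarrow>
            (powerful (Q \<sharp> R) \<longleftrightarrow>
              powerful Q \<and> powerful R \<and>
              ((only_zero_or_one Q \<and> 1 \<in> R \<or> only_zero_or_one R \<and> 1 \<in> Q) \<or>
               (card Q = card R \<and> 1 \<notin> Q \<and> 1 \<notin> R)))) \<and>
         (powerful (Q \<sharp> R) \<longrightarrow>
            \<not> (only_zero_or_one Q \<and> only_zero_or_one R) \<longrightarrow>
            \<not> vec.subspace (Q \<sharp> R))"
proof (intro conjI impI)
  assume "(\<exists>k. card Q = 2 ^ k) \<and> (\<exists>k. card R = 2 ^ k)"
  then obtain i j where "card Q = 2 ^ i" "card R = 2 ^ j"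
    by blast
  then show "powerful (Q \<sharp> R) \<longleftrightarrow>
      powerful Q \<and> powerful R \<and>
      ((only_zero_or_one Q \<and> 1 \<in> R \<or> only_zero_or_one R \<and> 1 \<in> Q) \<or>
       (card Q = card R \<and> 1 \<notin> Q \<and> 1 \<notin> R))"
    using powerful_hash_iff[of Q R] card_hash_eq_power_iff[of Q i R j] assms by blast
next
  assume "\<not> (only_zero_or_one Q \<and> only_zero_or_one R)"
  then show "\<not> vec.subspace (Q \<sharp> R)"
    using subspace_hash_imp_only_zero_or_one[OF assms] by blast
qed

end
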